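(* Let $m\ge 1$ be an integer, let $(A_k)_{k\ge 1}$ be an $m$-dependent sequence of events on a probability space with probability measure $\mathbb{P}$, and let $\phi:\mathbb{N}\to\mathbb{N}$ be a non-decreasing function with $$\sum_{k=1}^{\phi(n)}\mathbb{P}(A_k)\ge n\qquad\text{for all integers } n\ge 1.$$ Then for every integer $N\ge 1$ and all integers $i\ge 0$, $$\mathbb{P}\Bigl(\bigcup_{k=i+1}^{\phi(i+N)}A_k\Bigr)\ \ge\ 1-\exp\Bigl(-\frac{N}{m+1}\Bigr).$$
   Context: For finite index sets $I,J\subseteq\mathbb{N}$, put $\mathrm{dist}(I,J)=\inf\{|i-j| : i\in I,\ j\in J\}$. A sequence of events $(A_k)_{k\ge 1}$ on a probability space is called $m$-dependent if, whenever $I,J$ are finite sets of indices (positive integers) with $\mathrm{dist}(I,J)>m$, the sigma-algebras generated by $\{A_i : i\in I\}$ and by $\{A_j : j\in J\}$ are independent. Here $\mathbb{N}=\{1,2,3,\dots\}$. *)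

theory Defs
  imports "HOL-Probability.Probability" "HOL-Library.Extended_Nat"
begin

(* Extended naturals, so that the infimum over the empty set is infinity. *)
definition index_dist :: "nat set \<Rightarrow> nat set \<Rightarrow> enat" where
  "index_dist I J = Inf {enat (nat \<bar>int i - int j\<bar>) | i j. i \<in> I \<and> j \<in> J}"

(* The sequence is indexed by the positive integers; the value at index 0 is irrelevant.
   M is meant to be a probability space. *)
definition m_dependent :: "'a measure \<Rightarrow> nat \<Rightarrow> (nat \<Rightarrow> 'a set) \<Rightarrow> bool" where
  "m_dependent M m A \<longleftrightarrow>
     (\<forall>I J. finite I \<and> finite J \<and> I \<subseteq> {1..} \<and> J \<subseteq> {1..} \<and> index_dist I J > enat m \<longrightarrow>
        prob_space.indep_set M (sigma_sets (space M) (A ` I)) (sigma_sets (space M) (A ` J)))"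

end

theory Submission
  imports Defs
begin

text \<open>
  Indices in one residue class modulo \<open>m + 1\<close> are more than \<open>m\<close> apart, so \<open>m\<close>-dependence makes the
  corresponding events mutually independent, and the probability that none of them occurs is a
  product of factors \<open>1 - P(A k) \<le> exp (- P(A k))\<close>. It therefore suffices to find a class
  within the window \<open>{i+1..\<phi> (i+N)}\<close> whose probabilities sum to at least \<open>N / (m+1)\<close>. The whole
  window has sum at least \<open>(i + N) - i = N\<close>, because the \<open>i\<close> discarded probabilities are each at
  most 1, and one of the \<open>m + 1\<close> classes carries at least the average share.
\<close>

lemma index_dist_gt_iff:
  "index_dist I J > enat m \<longleftrightarrow> (\<forall>i\<in>I. \<forall>j\<in>J. \<bar>int i - int j\<bar> > int m)"
proof -
  have "index_dist I J > enat m \<longleftrightarrow> enat (Suc m) \<le> index_dist I J"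
    by (metis eSuc_enat ileI1 iless_Suc_eq linorder_not_less order_less_le_trans enat_ord_simps(2) lessI)
  also have "\<dots> \<longleftrightarrow> (\<forall>i\<in>I. \<forall>j\<in>J. Suc m \<le> nat \<bar>int i - int j\<bar>)"
    unfolding index_dist_def le_Inf_iff by fastforce
  also have "\<dots> \<longleftrightarrow> (\<forall>i\<in>I. \<forall>j\<in>J. \<bar>int i - int j\<bar> > int m)"
    by (intro ball_cong refl) linarith
  finally show ?thesis .
qed

text \<open>
  Removing one index from a separated set leaves it at distance more than \<open>m\<close> from the rest, so the
  independence of two index blocks already yields the full product formula by induction.
\<close>

lemma (in prob_space) m_dependent_prob_none_of_separated:
  assumes dep: "m_dependent M m A"
    and "finite S" "S \<subseteq> {1..}"
    and "\<And>i j. i \<in> S \<Longrightarrow> j \<in> S \<Longrightarrow> i \<noteq> j \<Longrightarrow> \<bar>int i - int j\<bar> > int m"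
    and ev: "\<And>k. k \<in> S \<Longrightarrow> A k \<in> events"
  shows "prob (space M - (\<Union>k\<in>S. A k)) = (\<Prod>k\<in>S. 1 - prob (A k))"
  using assms(2-5)
proof (induction S rule: finite_induct)
  case empty
  then show ?case by (simp add: prob_space)
next
  case (insert x S)
  have "index_dist {x} S > enat m"
    unfolding index_dist_gt_iff using insert.prems(2) insert.hyps(2) by fastforce
  then have ind: "indep_set (sigma_sets (space M) (A ` {x})) (sigma_sets (space M) (A ` S))"
    using dep insert.prems(1) \<open>finite S\<close> unfolding m_dependent_def by (metis finite.emptyI
      finite.insertI insert_subset empty_subsetI)
  have "space M - A x \<in> sigma_sets (space M) (A ` {x})"
    by (auto intro: sigma_sets.intros)
  moreover have "space M - (\<Union>k\<in>S. A k) \<in> sigma_sets (space M) (A ` S)"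
    using \<open>finite S\<close>
    by (intro sigma_sets.Compl sigma_sets_UNION countable_finite) auto
  ultimately have "prob ((space M - A x) \<inter> (space M - (\<Union>k\<in>S. A k)))
      = prob (space M - A x) * prob (space M - (\<Union>k\<in>S. A k))"
    by (rule indep_setD[OF ind])
  moreover have "space M - (\<Union>k\<in>insert x S. A k) = (space M - A x) \<inter> (space M - (\<Union>k\<in>S. A k))"
    by auto
  moreover have "prob (space M - A x) = 1 - prob (A x)"
    using insert.prems(3) by (simp add: prob_compl)
  ultimately show ?case
    using insert by simp
qed

lemma (in prob_space) m_dependent_prob_Union_separated_ge:
  assumes "m_dependent M m A" "finite S" "S \<subseteq> {1..}"
    and "\<And>i j. i \<in> S \<Longrightarrow> j \<in> S \<Longrightarrow> i \<noteq> j \<Longrightarrow> \<bar>int i - int j\<bar> > int m"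
    and ev: "\<And>k. k \<in> S \<Longrightarrow> A k \<in> events"
  shows "prob (\<Union>k\<in>S. A k) \<ge> 1 - exp (- (\<Sum>k\<in>S. prob (A k)))"
proof -
  have "1 - prob (\<Union>k\<in>S. A k) = prob (space M - (\<Union>k\<in>S. A k))"
    using ev \<open>finite S\<close> by (intro prob_compl[symmetric]) auto
  also have "\<dots> = (\<Prod>k\<in>S. 1 - prob (A k))"
    by (rule m_dependent_prob_none_of_separated[OF assms])
  also have "\<dots> \<le> (\<Prod>k\<in>S. exp (- prob (A k)))"
    using exp_ge_add_one_self[of "- prob (A k)" for k] by (intro prod_mono) auto
  also have "\<dots> = exp (- (\<Sum>k\<in>S. prob (A k)))"
    using \<open>finite S\<close> by (simp add: exp_sum sum_negf[symmetric])
  finally show ?thesis by simp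
qed

lemma exists_residue_class_sum_ge_average:
  fixes p :: "nat \<Rightarrow> real"
  assumes "finite K" "d > 0"
  obtains r where "(\<Sum>k | k \<in> K \<and> k mod d = r. p k) \<ge> (\<Sum>k\<in>K. p k) / d"
proof -
  have "\<exists>r. (\<Sum>k | k \<in> K \<and> k mod d = r. p k) \<ge> (\<Sum>k\<in>K. p k) / d"
  proof (rule ccontr)
    assume "\<not> ?thesis"
    then have "(\<Sum>r<d. \<Sum>k | k \<in> K \<and> k mod d = r. p k) < (\<Sum>r<d. (\<Sum>k\<in>K. p k) / d)"
      using \<open>d > 0\<close> by (intro sum_strict_mono) (auto simp: not_le)
    moreover have "(\<Sum>r<d. \<Sum>k | k \<in> K \<and> k mod d = r. p k) = (\<Sum>k\<in>K. p k)"
      using assms by (intro sum.group) auto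
    ultimately show False
      using \<open>d > 0\<close> by simp
  qed
  then show ?thesis using that by blast
qed

lemma abs_diff_gt_if_mod_Suc_eq:
  assumes "i mod Suc m = j mod Suc m" "i \<noteq> j"
  shows "\<bar>int i - int j\<bar> > int m"
proof -
  have "int (Suc m) dvd int i - int j"
    using assms(1) by (metis mod_eq_dvd_iff of_nat_mod)
  then have "\<bar>int (Suc m)\<bar> \<le> \<bar>int i - int j\<bar>"
    using assms(2) by (intro dvd_imp_le_int) auto
  then show ?thesis by simp
qed

theorem corollary3:
  fixes M :: "'a measure" and A :: "nat \<Rightarrow> 'a set" and \<phi> :: "nat \<Rightarrow> nat" and m :: nat
  assumes "prob_space M"
    and "m \<ge> 1"
    and "\<And>k. k \<ge> 1 \<Longrightarrow> A k \<in> sets M"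
    and "m_dependent M m A"
    and "\<And>n. n \<ge> 1 \<Longrightarrow> \<phi> n \<ge> 1"
    and "mono_on {1..} \<phi>"
    and "\<And>n. n \<ge> 1 \<Longrightarrow> (\<Sum>k = 1..\<phi> n. measure M (A k)) \<ge> real n"
  shows "\<forall>N\<ge>1. \<forall>i. measure M (\<Union>k\<in>{i+1..\<phi> (i + N)}. A k) \<ge> 1 - exp (- (real N / (real m + 1)))"
proof (intro allI impI)
  fix N i :: nat
  assume "N \<ge> 1"
  interpret prob_space M by fact
  define K where "K = {i+1..\<phi> (i + N)}"
  have "real (i + N) \<le> (\<Sum>k = 1..\<phi> (i + N). prob (A k))"
    using \<open>N \<ge> 1\<close> by (intro assms(7)) simp
  also have "\<dots> \<le> (\<Sum>k \<in> {1..i} \<union> K. prob (A k))"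
    by (intro sum_mono2) (auto simp: K_def)
  also have "\<dots> = (\<Sum>k = 1..i. prob (A k)) + (\<Sum>k\<in>K. prob (A k))"
    by (intro sum.union_disjoint) (auto simp: K_def)
  also have "(\<Sum>k = 1..i. prob (A k)) \<le> real i"
    using sum_bounded_above[of "{1..i}" "\<lambda>k. prob (A k)" 1] by simp
  finally have window: "real N \<le> (\<Sum>k\<in>K. prob (A k))" by simp
  obtain r where r: "(\<Sum>k | k \<in> K \<and> k mod Suc m = r. prob (A k)) \<ge> (\<Sum>k\<in>K. prob (A k)) / Suc m"
    by (rule exists_residue_class_sum_ge_average[of K "Suc m" "\<lambda>k. prob (A k)"])
      (simp_all add: K_def)
  define S where "S = {k \<in> K. k mod Suc m = r}"
  have "real N / (real m + 1) \<le> (\<Sum>k\<in>K. prob (A k)) / Suc m"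
    using window by (simp add: divide_right_mono add.commute)
  with r have "real N / (real m + 1) \<le> (\<Sum>k\<in>S. prob (A k))"
    unfolding S_def by linarith
  then have "1 - exp (- (real N / (real m + 1))) \<le> 1 - exp (- (\<Sum>k\<in>S. prob (A k)))"
    by simp
  also have "\<dots> \<le> prob (\<Union>k\<in>S. A k)"
  proof (rule m_dependent_prob_Union_separated_ge[OF assms(4)])
    show "\<bar>int i - int j\<bar> > int m" if "i \<in> S" "j \<in> S" "i \<noteq> j" for i j
      using that by (intro abs_diff_gt_if_mod_Suc_eq) (auto simp: S_def)
  qed (use assms(3) in \<open>auto simp: S_def K_def\<close>)
  also have "\<dots> \<le> prob (\<Union>k\<in>K. A k)"
    using assms(3) by (intro finite_measure_mono) (auto simp: S_def K_def)
  finally show "prob (\<Union>k\<in>{i+1..\<phi> (i + N)}. A k) \<ge> 1 - exp (- (real N / (real m + 1)))"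
    unfolding K_def .
qed

end
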